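(* Assume that the numerical Hamiltonian $\mathcal{H}$ satisfies (H1), (H2), and at least one of (H3) or (H4) (all stated in the context). Then: (i) there exists a unique $u\in\mathbb{R}^V$ solving the discrete problem $$\mathcal{H}(x_j,u_j,\nabla_G u_j)=0\ \ (j\in\mathcal{J}),\qquad u_j=g_j\ \ (j\in\mathcal{B}).$$ (ii) Let $\mu_b>0$ and $$L(u):=\frac{1}{|\mathcal{J}|}\sum_{j\in\mathcal{J}}\big(\mathcal{H}(x_j,u_j,\nabla_G u_j)\big)^2+\frac{\mu_b}{|\mathcal{B}|}\sum_{j\in\mathcal{B}}(u_j-g_j)^2 ,\qquad u\in\mathbb{R}^V.$$ The solution of the discrete problem is the unique critical point of $L$: for $u\in\mathbb{R}^V$, $$0\in\partial L(u)\quad\text{if and only if}\quad \mathcal{R}(u)=0 .$$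
   Context: Setting. $V$ is a finite index set, $\{x_j\}_{j\in V}$ are nodes which are the vertices of a directed graph; $\mathcal{V}_j\subset V$ is the set of (out-)neighbors of $j$, with $j\notin\mathcal{V}_j$. Put $\mathcal{J}:=\{j\in V:\mathcal{V}_j\neq\emptyset\}$ (interior) and $\mathcal{B}:=\{j\in V:\mathcal{V}_j=\emptyset\}$ (boundary), both assumed non-empty. For $k\in\mathcal{V}_j$, $\Delta x_{jk}>0$ is the distance between $x_j$ and $x_k$. For $u\in\mathbb{R}^V$ and $j\in\mathcal{J}$, $\nabla_G u_j:=\{(u_j-u_k)/\Delta x_{jk}\}_{k\in\mathcal{V}_j}\in\mathbb{R}^{|\mathcal{V}_j|}$. For each $j\in\mathcal{J}$ a numerical Hamiltonian $\mathcal{H}(x_j,\cdot,\cdot):\mathbb{R}\times\mathbb{R}^{|\mathcal{V}_j|}\to\mathbb{R}$ is given; the components of its last variable $p$ are indexed by $k\in\mathcal{V}_j$. Boundary values $\{g_j\}_{j\in\mathcal{B}}$ are given. Residual: for an arbitrary constant $\lambda_b>0$, $\mathcal{R}:\mathbb{R}^V\to\mathbb{R}^V$ is $\mathcal{R}(u)_j:=\mathcal{H}(x_j,u_j,\nabla_G u_j)$ for $j\in\mathcal{J}$ and $\mathcal{R}(u)_j:=\lambda_b(u_j-g_j)$ for $j\in\mathcal{B}$. Hypotheses. (H1) There are constants $[\mathcal{H}]_u,[\mathcal{H}]_p>0$, independent of $x_j$, such that $|\mathcal{H}(x_j,u,p)-\mathcal{H}(x_j,v,p)|\le[\mathcal{H}]_u|u-v|$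 and $|\mathcal{H}(x_j,u,p)-\mathcal{H}(x_j,u,q)|\le[\mathcal{H}]_p\|p-q\|_\infty$ for all $j\in\mathcal{J}$, $u,v\in\mathbb{R}$, $p,q\in\mathbb{R}^{|\mathcal{V}_j|}$. (H2) For all $j\in\mathcal{J}$, $u,v\in\mathbb{R}$, $p,q\in\mathbb{R}^{|\mathcal{V}_j|}$: $p\le q$ componentwise implies $\mathcal{H}(x_j,u,p)\le\mathcal{H}(x_j,u,q)$; and $u\le v$ implies $\mathcal{H}(x_j,u,p)\le\mathcal{H}(x_j,v,p)$. (H3) There is $\lambda>0$ such that for all $j\in\mathcal{J}$, $u,v\in\mathbb{R}$, $p\in\mathbb{R}^{|\mathcal{V}_j|}$: $v\ge u$ implies $\mathcal{H}(x_j,v,p)-\mathcal{H}(x_j,u,p)\ge\lambda(v-u)$. (H4) (i) There is $\underline\alpha>0$ such that for all $j\in\mathcal{J}$, $u\in\mathbb{R}$, $k\in\mathcal{V}_j$: $\frac{\partial\mathcal{H}}{\partial p_k}(x_j,u,p)\ge\underline\alpha$ for a.e. $p\in\mathbb{R}^{|\mathcal{V}_j|}$. (ii) For any $j\in\mathcal{J}$ there are $n\in\mathbb{N}$, $(j_1,\dots,j_n)\in\mathcal{J}^n$ and $j_{n+1}\in\mathcal{B}$ with $j_1=j$ and $j_{k+1}\in\mathcal{V}_{j_k}$ for $k=1,\dots,n$. (iii) For any $j,k\in\mathcal{J}$: $j\in\mathcal{V}_k$ if and only if $k\in\mathcal{V}_j$. Generalized differential: $\partial L(u)$ is the convex hull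 of all limits of $\nabla L(u_n)$ over sequences $(u_n)$ of differentiability points of $L$ converging to $u$. *)

theory Defs
  imports "HOL-Analysis.Analysis"
begin

(* The index set V is a finite type 'v and R^V is real^'v.  The graph is given by its map of
   out-neighbours N :: 'v => 'v set, and dx j k is the distance between the nodes x_j and x_k;
   only its values for k in N j are used. *)

definition interior_nodes :: "('v \<Rightarrow> 'v set) \<Rightarrow> 'v set" where
  "interior_nodes N = {j. N j \<noteq> {}}"

definition boundary_nodes :: "('v \<Rightarrow> 'v set) \<Rightarrow> 'v set" where
  "boundary_nodes N = {j. N j = {}}"

(* R^A, with components indexed by the elements of A.  It is also the underlying space of the
   product measure used in (H4). *)
abbreviation vectors_on :: "'v set \<Rightarrow> ('v \<Rightarrow> real) set" where
  "vectors_on A \<equiv> A \<rightarrow>\<^sub>E UNIV"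

definition grad_G ::
  "('v \<Rightarrow> 'v set) \<Rightarrow> ('v \<Rightarrow> 'v \<Rightarrow> real) \<Rightarrow> real^'v \<Rightarrow> 'v \<Rightarrow> ('v \<Rightarrow> real)" where
  "grad_G N dx u j = (\<lambda>k\<in>N j. (u $ j - u $ k) / dx j k)"

(* Meaningful for finite, non-empty A. *)
definition sup_norm_on :: "'v set \<Rightarrow> ('v \<Rightarrow> real) \<Rightarrow> real" where
  "sup_norm_on A p = (MAX k\<in>A. \<bar>p k\<bar>)"

(* A numerical Hamiltonian is a function H such that H j u p is H(x_j, u, p).  It is only
   evaluated at interior j and at p in vectors_on (N j), that is, at p in R^(N j). *)

definition H1 :: "('v \<Rightarrow> 'v set) \<Rightarrow> ('v \<Rightarrow> real \<Rightarrow> ('v \<Rightarrow> real) \<Rightarrow> real) \<Rightarrow> bool" where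
  "H1 N H \<longleftrightarrow> (\<exists>Cu>0. \<exists>Cp>0. \<forall>j\<in>interior_nodes N. \<forall>u v.
     \<forall>p\<in>vectors_on (N j). \<forall>q\<in>vectors_on (N j).
       \<bar>H j u p - H j v p\<bar> \<le> Cu * \<bar>u - v\<bar> \<and>
       \<bar>H j u p - H j u q\<bar> \<le> Cp * sup_norm_on (N j) (\<lambda>k. p k - q k))"

definition H2 :: "('v \<Rightarrow> 'v set) \<Rightarrow> ('v \<Rightarrow> real \<Rightarrow> ('v \<Rightarrow> real) \<Rightarrow> real) \<Rightarrow> bool" where
  "H2 N H \<longleftrightarrow> (\<forall>j\<in>interior_nodes N. \<forall>u v.
     \<forall>p\<in>vectors_on (N j). \<forall>q\<in>vectors_on (N j).
       ((\<forall>k\<in>N j. p k \<le> q k) \<longrightarrow> H j u p \<le> H j u q) \<and>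
       (u \<le> v \<longrightarrow> H j u p \<le> H j v p))"

definition H3 :: "('v \<Rightarrow> 'v set) \<Rightarrow> ('v \<Rightarrow> real \<Rightarrow> ('v \<Rightarrow> real) \<Rightarrow> real) \<Rightarrow> bool" where
  "H3 N H \<longleftrightarrow> (\<exists>lam>0. \<forall>j\<in>interior_nodes N. \<forall>u v. \<forall>p\<in>vectors_on (N j).
     u \<le> v \<longrightarrow> lam * (v - u) \<le> H j v p - H j u p)"

(* The first conjunct asserts that, for a.e. p, the partial derivative in direction k exists
   and is at least alpha; under (H1) it exists for a.e. p in any case. *)
definition H4 :: "('v \<Rightarrow> 'v set) \<Rightarrow> ('v \<Rightarrow> real \<Rightarrow> ('v \<Rightarrow> real) \<Rightarrow> real) \<Rightarrow> bool" where
  "H4 N H \<longleftrightarrow>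
     (\<exists>\<alpha>>0. \<forall>j\<in>interior_nodes N. \<forall>u. \<forall>k\<in>N j.
        AE p in Pi\<^sub>M (N j) (\<lambda>_. lborel).
          \<exists>d\<ge>\<alpha>. ((\<lambda>t. H j u (p(k := t))) has_real_derivative d) (at (p k))) \<and>
     (\<forall>j\<in>interior_nodes N. \<exists>n\<ge>1. \<exists>c :: nat \<Rightarrow> 'v.
        c 1 = j \<and> (\<forall>i\<in>{1..n}. c i \<in> interior_nodes N) \<and> c (n + 1) \<in> boundary_nodes N \<and>
        (\<forall>i\<in>{1..n}. c (i + 1) \<in> N (c i))) \<and>
     (\<forall>j\<in>interior_nodes N. \<forall>k\<in>interior_nodes N. j \<in> N k \<longleftrightarrow> k \<in> N j)"

definition solves ::
  "('v \<Rightarrow> 'v set) \<Rightarrow> ('v \<Rightarrow> 'v \<Rightarrow> real) \<Rightarrow> ('v \<Rightarrow> real \<Rightarrow> ('v \<Rightarrow> real) \<Rightarrow> real) \<Rightarrow>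
   ('v \<Rightarrow> real) \<Rightarrow> real^'v \<Rightarrow> bool" where
  "solves N dx H g u \<longleftrightarrow>
     (\<forall>j\<in>interior_nodes N. H j (u $ j) (grad_G N dx u j) = 0) \<and>
     (\<forall>j\<in>boundary_nodes N. u $ j = g j)"

definition residual ::
  "('v \<Rightarrow> 'v set) \<Rightarrow> ('v \<Rightarrow> 'v \<Rightarrow> real) \<Rightarrow> ('v \<Rightarrow> real \<Rightarrow> ('v \<Rightarrow> real) \<Rightarrow> real) \<Rightarrow>
   ('v \<Rightarrow> real) \<Rightarrow> real \<Rightarrow> real^'v \<Rightarrow> real^'v" where
  "residual N dx H g lam_b u =
     (\<chi> j. if j \<in> interior_nodes N then H j (u $ j) (grad_G N dx u j)
           else lam_b * (u $ j - g j))"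

definition loss ::
  "('v \<Rightarrow> 'v set) \<Rightarrow> ('v \<Rightarrow> 'v \<Rightarrow> real) \<Rightarrow> ('v \<Rightarrow> real \<Rightarrow> ('v \<Rightarrow> real) \<Rightarrow> real) \<Rightarrow>
   ('v \<Rightarrow> real) \<Rightarrow> real \<Rightarrow> real^'v \<Rightarrow> real" where
  "loss N dx H g mu_b u =
     1 / real (card (interior_nodes N)) *
       (\<Sum>j\<in>interior_nodes N. (H j (u $ j) (grad_G N dx u j))\<^sup>2) +
     mu_b / real (card (boundary_nodes N)) * (\<Sum>j\<in>boundary_nodes N. (u $ j - g j)\<^sup>2)"

definition gen_differential :: "('a::euclidean_space \<Rightarrow> real) \<Rightarrow> 'a \<Rightarrow> 'a set" where
  "gen_differential L u = convex hull
     {d. \<exists>w D. (\<forall>n::nat. GDERIV L (w n) :> D n) \<and> w \<longlonglongrightarrow> u \<and> D \<longlonglongrightarrow> d}"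

end

theory Submission
  imports Defs
begin

text \<open>
  Write $F$ for the residual with boundary constant $1$ and $F_j$ for its components. Everything
  follows from one discrete comparison principle: there are weights $\varphi > 0$ and a rate
  $c > 0$ such that, if $w - v$ attains its weighted maximum at $j$, that is, if
  $w_j - v_j = t \varphi_j$ and $w_k - v_k \le t \varphi_k$ for all $k$, with $t \ge 0$, then
  $F_j(w) - F_j(v) \ge c t$. This is what the locale \<open>weighted_comparison\<close> assumes.

  Uniqueness. Applied at the index where $(w_j - v_j) / \varphi_j$ is largest, the principle bounds
  $w - v$ by $F(w) - F(v)$. So $F$ is injective and $|F|$ is coercive.

  Critical points. Let $F(u) \neq 0$ and $e_j = -\mathrm{sgn}(F_j(u))\, \varphi_j$. No component of
  $e$ exceeds its weight in absolute value, so the principle applies at every $j$ with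
  $F_j(u) \neq 0$: along $e$ each such component moves against its sign at $u$ at a rate of at
  least $c$, from any starting point. Components that vanish at $u$ stay small near $u$ and contribute little to a
  sum of squares. Hence a weighted sum of squares of the $F_j$ decreases along $e$ at a uniform
  rate $\eta > 0$ from all points near $u$. All gradients at nearby points lie in the half-space
  $\{d.\ e \cdot d \le -\eta\}$, which is closed and convex. The generalized differential at $u$ is
  therefore contained in it, and $0$ is not. The direction $e$ takes the place of the chain rule
  and of the convexity of the set of generalized Jacobians. Conversely, at a zero of $F$ the loss
  is squeezed between $0$ and a multiple of the squared distance, so that it is differentiable
  there with gradient $0$.

  Existence. The same descent direction shows that a minimizer of $|F|$, which exists by
  coercivity, is a zero.

  The weights. Under (H3) take $\varphi = 1$: at the maximum all slopes increase, and $u_j$ itself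
  increases by $t$. Under (H4) take $\varphi = 2 - \theta^{d}$ with $d$ the graph distance to the
  boundary and $\theta$ small. Every interior node has a neighbour closer to the boundary; the
  increase of the slope towards it is of order $t \theta^{d-1}$ and outweighs the decreases of the
  other slopes, which are of order $t \theta^{d}$. This requires that $\mathcal{H}$ grow in each
  slope at the rate $\underline\alpha$ from every point, whereas (H4) bounds a derivative almost
  everywhere only. Fubini gives the bound on almost every line, a Lipschitz function of one variable
  is controlled by its derivative almost everywhere, and by continuity the resulting increments are
  bounded on every line.
\<close>

section \<open>Growth from a bound on almost every partial derivative\<close>

text \<open>
  Suppose the increment over $[a, b]$ is too small. For some slope $\beta < \alpha$ the function
  $h(x) = f(x) - \beta x$ then satisfies $h(b) < h(a)$, although its derivative is positive outside
  a null set $Z$. Lipschitz maps send null sets to null sets, so some level $y$ between $h(b)$ and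
  $h(a)$ is not taken on $Z$. At the last point where $h \ge y$, the value is $y$ and the
  derivative is positive, so $h > y$ a little further on: a contradiction.
\<close>
lemma Lipschitz_AE_deriv_ge_growth:
  fixes f :: "real \<Rightarrow> real"
  assumes lip: "C-lipschitz_on UNIV f"
    and AE: "AE x in lborel. \<exists>d\<ge>\<alpha>. (f has_real_derivative d) (at x)"
    and ab: "a \<le> b"
  shows "\<alpha> * (b - a) \<le> f b - f a"
proof (rule ccontr)
  assume "\<not> \<alpha> * (b - a) \<le> f b - f a"
  with ab have less: "f b - f a < \<alpha> * (b - a)" and "a < b"
    by (auto simp: not_le order_le_less)
  then have "(f b - f a) / (b - a) < \<alpha>" by (simp add: divide_less_eq)
  then obtain \<beta> where \<beta>: "(f b - f a) / (b - a) < \<beta>" "\<beta> < \<alpha>" using dense by blast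
  define h where "h x = f x - \<beta> * x" for x
  have hab: "h b < h a" using \<beta>(1) \<open>a < b\<close> by (simp add: h_def divide_less_eq algebra_simps)
  define Z where "Z = {x. \<not> (\<exists>d\<ge>\<alpha>. (f has_real_derivative d) (at x))}"
  have "negligible Z"
    using AE_completion[OF AE]
    by (simp add: Z_def negligible_iff_null_sets completion.AE_iff_null_sets null_sets_completion_subset)
  have lip_h: "\<bar>h y - h x\<bar> \<le> (C + \<bar>\<beta>\<bar>) * \<bar>y - x\<bar>" for x y
  proof -
    have "\<bar>f y - f x\<bar> \<le> C * \<bar>y - x\<bar>" using lipschitz_onD[OF lip, of y x] by (simp add: dist_real_def)
    moreover have "\<bar>\<beta> * (y - x)\<bar> = \<bar>\<beta>\<bar> * \<bar>y - x\<bar>" by (rule abs_mult)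
    ultimately show ?thesis unfolding h_def by (simp add: algebra_simps)
  qed
  have "negligible (h ` Z)"
    by (rule negligible_locally_Lipschitz_image[OF _ \<open>negligible Z\<close>])
       (use lip_h in \<open>auto intro!: exI[of _ UNIV] exI[of _ "C + \<bar>\<beta>\<bar>"]\<close>)
  moreover have "\<not> negligible {h b<..<h a}" using hab by (intro open_not_negligible) auto
  ultimately obtain y where y: "h b < y" "y < h a" "y \<notin> h ` Z"
    by (meson greaterThanLessThan_iff negligible_subset subsetI)
  have cont: "continuous_on S h" for S
    unfolding h_def by (intro continuous_intros lipschitz_on_continuous_on[OF lipschitz_on_subset[OF lip subset_UNIV]])
  define S where "S = {x\<in>{a..b}. y \<le> h x}"
  have "closed S" unfolding S_def
    by (auto intro!: closed_Collect_conj closed_Collect_le cont)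
  moreover have "bounded S" by (rule bounded_subset[of "{a..b}"]) (auto simp: S_def)
  ultimately have "compact S" by (simp add: compact_eq_bounded_closed)
  moreover have "a \<in> S" using y ab by (simp add: S_def)
  ultimately obtain x where x: "x \<in> S" and max: "\<And>z. z \<in> S \<Longrightarrow> z \<le> x"
    using compact_attains_sup[of S] by auto
  have "x < b" using x y(1) by (cases "x = b") (auto simp: S_def)
  obtain z where z: "x \<le> z" "z \<le> b" "h z = y"
    using IVT2'[of h b y x] x y \<open>x < b\<close> cont by (auto simp: S_def)
  then have "z \<in> S" using x by (simp add: S_def)
  with max z have hx: "h x = y" by (metis antisym)
  then have "x \<notin> Z" using y(3) by blast
  then obtain d where d: "d \<ge> \<alpha>" "(f has_real_derivative d) (at x)" by (auto simp: Z_def)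
  have "(h has_real_derivative d - \<beta>) (at x)"
    unfolding h_def by (auto intro!: derivative_eq_intros d)
  from DERIV_pos_inc_right[OF this] d \<beta>(2) obtain r where r: "r > 0"
    "\<And>s. 0 < s \<Longrightarrow> s < r \<Longrightarrow> h x < h (x + s)" by auto
  define s where "s = min (r / 2) (b - x)"
  have "0 < s" "s < r" "x + s \<le> b" using r(1) \<open>x < b\<close> by (auto simp: s_def)
  then have "x + s \<in> S" using r(2)[of s] x hx by (simp add: S_def)
  with max[of "x + s"] \<open>0 < s\<close> show False by simp
qed

lemma (in product_sigma_finite) AE_PiM_insert:
  assumes [simp]: "finite I" "i \<notin> I" and AE: "AE p in Pi\<^sub>M (insert i I) M. P p"
  shows "AE p in Pi\<^sub>M I M. AE t in M i. P (p(i := t))"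
proof -
  obtain Z where Z[measurable]: "Z \<in> sets (Pi\<^sub>M (insert i I) M)"
    and Z0: "emeasure (Pi\<^sub>M (insert i I) M) Z = 0"
    and PZ: "{p\<in>space (Pi\<^sub>M (insert i I) M). \<not> P p} \<subseteq> Z"
    using AE unfolding eventually_ae_filter by auto
  interpret i: sigma_finite_measure "M i" by (rule sigma_finite_measures)
  have "0 = (\<integral>\<^sup>+ p. indicator Z p \<partial>Pi\<^sub>M (insert i I) M)" using Z0 by simp
  also have "\<dots> = (\<integral>\<^sup>+ p. (\<integral>\<^sup>+ t. indicator Z (p(i := t)) \<partial>M i) \<partial>Pi\<^sub>M I M)"
    by (rule product_nn_integral_insert) auto
  finally have ae: "AE p in Pi\<^sub>M I M. (\<integral>\<^sup>+ t. indicator Z (p(i := t)) \<partial>M i) = 0"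
    by (subst (asm) eq_commute) (subst (asm) nn_integral_0_iff_AE, measurable)
  show ?thesis
  proof (rule AE_mp[OF ae AE_I2[OF impI]])
    fix p assume p: "p \<in> space (Pi\<^sub>M I M)"
      and "(\<integral>\<^sup>+ t. indicator Z (p(i := t)) \<partial>M i) = 0"
    then have ae': "AE t in M i. indicator Z (p(i := t)) = (0 :: ennreal)"
      by (subst (asm) nn_integral_0_iff_AE) measurable
    show "AE t in M i. P (p(i := t))"
    proof (rule AE_mp[OF ae' AE_I2[OF impI]])
      fix t assume "t \<in> space (M i)" "indicator Z (p(i := t)) = (0 :: ennreal)"
      then have "p(i := t) \<in> space (Pi\<^sub>M (insert i I) M)" "p(i := t) \<notin> Z"
        using p by (auto simp: indicator_def space_PiM PiE_fun_upd split: if_splits)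
      then show "P (p(i := t))" using PZ by blast
    qed
  qed
qed
lemma sup_norm_on_le:
  fixes A :: "'v::finite set"
  assumes "A \<noteq> {}" "\<And>i. i \<in> A \<Longrightarrow> \<bar>f i\<bar> \<le> b"
  shows "sup_norm_on A f \<le> b"
  unfolding sup_norm_on_def using assms by (intro Max.boundedI) auto

text \<open>
  A set of full measure meets every box since boxes have positive measure. In the form of a point
  near $x$, this is the density needed to pass from almost all points to all points by continuity.
\<close>
lemma AE_lborel_PiM_meets_box:
  assumes fin: "finite I" and AE: "AE p in Pi\<^sub>M I (\<lambda>_. lborel). P p" and \<epsilon>: "\<epsilon> > (0 :: real)"
  obtains p where "p \<in> (\<Pi>\<^sub>E i\<in>I. {x i - \<epsilon><..<x i + \<epsilon>})" "P p"
proof -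
  interpret product_sigma_finite "\<lambda>_ :: 'a. lborel :: real measure" ..
  let ?B = "\<Pi>\<^sub>E i\<in>I. {x i - \<epsilon><..<x i + \<epsilon>}"
  have "\<exists>p\<in>?B. P p"
  proof (rule ccontr)
    assume "\<not> (\<exists>p\<in>?B. P p)"
    with AE have "AE p in Pi\<^sub>M I (\<lambda>_. lborel). \<not> p \<in> ?B" by (auto elim: eventually_mono)
    then have "emeasure (Pi\<^sub>M I (\<lambda>_. lborel)) {p \<in> space (Pi\<^sub>M I (\<lambda>_. lborel)). p \<in> ?B} = 0"
      by (rule emeasure_eq_0_AE)
    also have "{p \<in> space (Pi\<^sub>M I (\<lambda>_. lborel)). p \<in> ?B} = ?B"
      by (auto simp: space_PiM PiE_def)
    also have "emeasure (Pi\<^sub>M I (\<lambda>_. lborel)) ?B = (\<Prod>i\<in>I. ennreal (2 * \<epsilon>))"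
      using \<epsilon> by (subst emeasure_PiM[OF fin]) (auto intro!: prod.cong)
    finally show False using \<epsilon> fin by simp
  qed
  then show ?thesis using that by blast
qed

text \<open>
  By Fubini, on almost every line in direction $k$ the derivative is at least $\alpha$ almost
  everywhere, which gives the increment on that line. Such lines come arbitrarily close to any given
  one, and the increments of the Lipschitz function $h$ depend continuously on the line.
\<close>
lemma AE_partial_deriv_ge_growth:
  fixes h :: "('v::finite \<Rightarrow> real) \<Rightarrow> real"
  assumes k: "k \<in> A" and C: "C > 0"
    and lip: "\<And>p q. \<lbrakk>p \<in> vectors_on A; q \<in> vectors_on A\<rbrakk>
      \<Longrightarrow> \<bar>h p - h q\<bar> \<le> C * sup_norm_on A (\<lambda>i. p i - q i)"
    and AE: "AE p in Pi\<^sub>M A (\<lambda>_. lborel).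
      \<exists>d\<ge>\<alpha>. ((\<lambda>t. h (p(k := t))) has_real_derivative d) (at (p k))"
    and p: "p \<in> vectors_on A" and st: "s \<le> t"
  shows "\<alpha> * (t - s) \<le> h (p(k := t)) - h (p(k := s))"
proof -
  interpret product_sigma_finite "\<lambda>_ :: 'v. lborel :: real measure" ..
  let ?I = "A - {k}"
  have A: "insert k ?I = A" and "A \<noteq> {}" using k by auto
  have lip': "\<bar>h q - h r\<bar> \<le> C * b"
    if "q \<in> vectors_on A" "r \<in> vectors_on A" "\<And>i. i \<in> A \<Longrightarrow> \<bar>q i - r i\<bar> \<le> b" for q r b
  proof -
    have "sup_norm_on A (\<lambda>i. q i - r i) \<le> b" using that(3) \<open>A \<noteq> {}\<close> by (intro sup_norm_on_le)
    then show ?thesis using lip[OF that(1,2)] mult_left_mono[of _ b C] C by (meson less_imp_le order_trans)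
  qed
  have upd: "q(k := x) \<in> vectors_on A" if "q \<in> vectors_on ?I" for q x
    using that k by (auto simp: PiE_def extensional_def)
  have upd': "p(k := x) \<in> vectors_on A" for x
    using p k by (auto simp: PiE_def extensional_def)
  have ae: "AE q in Pi\<^sub>M ?I (\<lambda>_. lborel). AE x in lborel.
      \<exists>d\<ge>\<alpha>. ((\<lambda>t. h (q(k := t))) has_real_derivative d) (at x)"
    using AE_PiM_insert[of ?I k, unfolded A, OF _ _ AE] by simp
  show ?thesis
  proof (rule field_le_epsilon)
    fix e :: real assume "e > 0"
    \<comment> \<open>replacing the line changes both ends of the increment by at most \<^term>\<open>C * \<epsilon>\<close>\<close>
    define \<epsilon> where "\<epsilon> = e / (2 * C)"
    have \<epsilon>: "\<epsilon> > 0" using \<open>e > 0\<close> C by (simp add: \<epsilon>_def)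
    obtain q
      where q: "q \<in> (\<Pi>\<^sub>E i\<in>?I. {p i - \<epsilon><..<p i + \<epsilon>})"
        and good: "AE x in lborel. \<exists>d\<ge>\<alpha>. ((\<lambda>t. h (q(k := t))) has_real_derivative d) (at x)"
      by (rule AE_lborel_PiM_meets_box[OF finite ae \<epsilon>, of p])
    have qv: "q \<in> vectors_on ?I" using q by (auto simp: PiE_def)
    have "\<bar>h (q(k := x)) - h (q(k := y))\<bar> \<le> C * \<bar>x - y\<bar>" for x y
      by (rule lip'[OF upd[OF qv] upd[OF qv]]) simp
    then have "C-lipschitz_on UNIV (\<lambda>t. h (q(k := t)))"
      using C by (intro lipschitz_onI) (simp_all add: dist_real_def)
    then have "\<alpha> * (t - s) \<le> h (q(k := t)) - h (q(k := s))"
      using good st by (rule Lipschitz_AE_deriv_ge_growth)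
    moreover have near: "\<bar>h (q(k := x)) - h (p(k := x))\<bar> \<le> C * \<epsilon>" for x
    proof (rule lip'[OF upd[OF qv] upd'])
      fix i assume "i \<in> A"
      show "\<bar>(q(k := x)) i - (p(k := x)) i\<bar> \<le> \<epsilon>"
      proof (cases "i = k")
        case False
        then have "q i \<in> {p i - \<epsilon><..<p i + \<epsilon>}" using q \<open>i \<in> A\<close> by (intro PiE_mem[OF q]) simp
        then show ?thesis using False by (simp add: abs_le_iff)
      qed (use \<epsilon> in simp)
    qed
    moreover have "2 * (C * \<epsilon>) = e" using C by (simp add: \<epsilon>_def)
    ultimately show "\<alpha> * (t - s) \<le> h (p(k := t)) - h (p(k := s)) + e"
      using near[of t, unfolded abs_le_iff] near[of s, unfolded abs_le_iff] by linarith
  qed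
qed

section \<open>Maps with a weighted comparison principle\<close>

text \<open>
  For a linear map $F$ this says that $F \varphi \ge c$ in all components and that the
  off-diagonal entries are nonpositive: a nonsingular M-matrix. The comparison assumption is the
  nonlinear form of it, in which $w - t \varphi$ touches $v$ from below at $j$.
\<close>
locale weighted_comparison =
  fixes F :: "real^'v::finite \<Rightarrow> real^'v" and \<phi> :: "'v \<Rightarrow> real" and c K :: real
  assumes weight_pos: "\<phi> j > 0"
    and rate_pos: "c > 0"
    and lipschitz: "\<bar>F w $ j - F v $ j\<bar> \<le> K * norm (w - v)"
    and comparison: "\<lbrakk>0 \<le> t; w $ j - v $ j = t * \<phi> j; \<And>k. w $ k - v $ k \<le> t * \<phi> k\<rbrakk>
      \<Longrightarrow> c * t \<le> F w $ j - F v $ j"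
begin

lemma lipschitz_const_nonneg: "0 \<le> K"
proof -
  have "0 \<le> \<bar>F (axis undefined 1) $ undefined - F 0 $ undefined\<bar>" by simp
  also have "\<dots> \<le> K * norm (axis undefined (1::real) - 0 :: real^'v)" by (rule lipschitz)
  finally show ?thesis by simp
qed

lemma continuous: "continuous_on S F"
proof -
  have "K-lipschitz_on S (\<lambda>w. F w $ j)" for j
    using lipschitz lipschitz_const_nonneg by (auto intro!: lipschitz_onI simp: dist_norm)
  then have "continuous_on S (\<lambda>w. \<chi> j. F w $ j)"
    by (intro continuous_on_vec_lambda lipschitz_on_continuous_on)
  then show ?thesis by simp
qed

text \<open>
  Compare $w$ and $v$ at the index where $(w_j - v_j) / \varphi_j$ attains its maximum $t$; if
  $t < 0$ there is nothing to prove.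
\<close>
lemma one_sided_stability:
  "w $ k - v $ k \<le> \<phi> k / c * norm (F w - F v)"
proof -
  define t where "t = (MAX j. (w $ j - v $ j) / \<phi> j)"
  have le: "(w $ i - v $ i) / \<phi> i \<le> t" for i by (simp add: t_def)
  have le': "w $ i - v $ i \<le> t * \<phi> i" for i using weight_pos[of i] le[of i] by (simp add: pos_divide_le_eq)
  have "t \<in> range (\<lambda>j. (w $ j - v $ j) / \<phi> j)" unfolding t_def by (rule Max_in) auto
  then obtain j where "t = (w $ j - v $ j) / \<phi> j" by auto
  then have j: "w $ j - v $ j = t * \<phi> j" using weight_pos[of j] by simp
  have t: "c * t \<le> norm (F w - F v)"
  proof (cases "0 \<le> t")
    case True
    then have "c * t \<le> F w $ j - F v $ j" using j le' by (rule comparison)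
    also have "\<dots> \<le> norm (F w - F v)"
      using component_le_norm_cart[of "F w - F v" j] by simp
    finally show ?thesis .
  next
    case False
    then have "c * t \<le> 0" using rate_pos by (simp add: mult_le_0_iff)
    then show ?thesis by (rule order_trans) simp
  qed
  have "w $ k - v $ k \<le> t * \<phi> k" by (rule le')
  also have "\<dots> \<le> (norm (F w - F v) / c) * \<phi> k"
    using t weight_pos[of k] rate_pos by (intro mult_right_mono) (auto simp: pos_le_divide_eq mult.commute)
  finally show ?thesis by (simp add: mult.commute)
qed

lemma stability:
  "norm (w - v) \<le> (\<Sum>k\<in>UNIV. \<phi> k / c) * norm (F w - F v)"
proof -
  have "norm (w - v) \<le> (\<Sum>k\<in>UNIV. \<bar>(w - v) $ k\<bar>)" by (rule norm_le_l1_cart)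
  also have "\<dots> \<le> (\<Sum>k\<in>UNIV. \<phi> k / c * norm (F w - F v))"
    using one_sided_stability[of w _ v] one_sided_stability[of v _ w]
    by (intro sum_mono) (simp add: abs_le_iff norm_minus_commute[of "F w"])
  finally show ?thesis by (simp add: sum_distrib_right)
qed

lemma zero_unique: "F w = 0 \<Longrightarrow> F v = 0 \<Longrightarrow> w = v"
  using stability[of w v] by simp

definition energy :: "('v \<Rightarrow> real) \<Rightarrow> real^'v \<Rightarrow> real" where
  "energy m w = (\<Sum>j\<in>UNIV. m j * (F w $ j)\<^sup>2)"

text \<open>
  The sign is chosen against the residual at $u$, and the size is the weight: the
  comparison principle then applies at each $j$ with $F_j(u) \neq 0$, whatever the signs at the
  other indices.
\<close>
definition descent_direction :: "real^'v \<Rightarrow> real^'v" where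
  "descent_direction u = (\<chi> j. - sgn (F u $ j) * \<phi> j)"

text \<open>
  The rate holds from every starting point $w$; the point $u$ only fixes the signs. This is what
  later makes one direction serve for all gradients near $u$.
\<close>
lemma descent:
  assumes t: "0 \<le> t" and w': "w' = w + t *\<^sub>R descent_direction u"
  shows "(F w' $ j - F w $ j) * F u $ j \<le> - (c * t * \<bar>F u $ j\<bar>)"
proof -
  have bound: "\<bar>descent_direction u $ k\<bar> \<le> \<phi> k" for k
    using weight_pos[of k] by (simp add: descent_direction_def abs_mult abs_sgn_eq)
  then have bound': "descent_direction u $ k \<le> \<phi> k" "- descent_direction u $ k \<le> \<phi> k" for k
    by (simp_all add: abs_le_iff)
  consider "F u $ j = 0" | "F u $ j > 0" | "F u $ j < 0" by linarith
  then show ?thesis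
  proof cases
    case 1
    then show ?thesis by simp
  next
    case 2
    have "c * t \<le> F w $ j - F w' $ j"
    proof (rule comparison[OF t])
      show "w $ j - w' $ j = t * \<phi> j" using 2 by (simp add: w' descent_direction_def)
      show "w $ k - w' $ k \<le> t * \<phi> k" for k
        using mult_left_mono[OF bound'(2) t, of k] by (simp add: w')
    qed
    then show ?thesis using 2 mult_right_mono[of "c * t" "F w $ j - F w' $ j" "F u $ j"]
      by (simp add: algebra_simps)
  next
    case 3
    have "c * t \<le> F w' $ j - F w $ j"
    proof (rule comparison[OF t])
      show "w' $ j - w $ j = t * \<phi> j" using 3 by (simp add: w' descent_direction_def)
      show "w' $ k - w $ k \<le> t * \<phi> k" for k
        using mult_left_mono[OF bound'(1) t, of k] by (simp add: w')
    qed
    then show ?thesis using 3 mult_right_mono[of "c * t" "F w' $ j - F w $ j" "- F u $ j"]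
      by (simp add: algebra_simps)
  qed
qed

text \<open>
  With $w' = w + t e$,
  \[ F_j(w')^2 - F_j(w)^2 = 2 (F_j(w') - F_j(w)) F_j(u) + (F_j(w') - F_j(w)) (F_j(w') + F_j(w) - 2 F_j(u)). \]
  The first term is at most $- 2 c t |F_j(u)|$ by the previous lemma; the second one is $O(t \rho)$
  if $w$ and $w'$ have distance $O(\rho)$ from $u$. For small $\rho$ half of the first term survives.
\<close>
lemma energy_uniform_decrease:
  assumes m: "\<And>j. m j > 0" and nz: "F u \<noteq> 0"
  obtains \<eta> \<rho> where "\<eta> > 0" "\<rho> > 0"
    "\<And>w t. \<lbrakk>dist w u < \<rho>; 0 \<le> t; t < \<rho>\<rbrakk>
      \<Longrightarrow> energy m (w + t *\<^sub>R descent_direction u) \<le> energy m w - \<eta> * t"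
proof -
  define e where "e = descent_direction u"
  define M where "M = (\<Sum>j\<in>UNIV. m j)"
  define S where "S = (\<Sum>j\<in>UNIV. m j * \<bar>F u $ j\<bar>)"
  define E where "E = norm e"
  \<comment> \<open>the errors in the squares of the components have a weighted sum of at most \<^term>\<open>t * (Q * \<rho>)\<close>\<close>
  define Q where "Q = M * K * E * K * (2 + E)"
  \<comment> \<open>small enough for the error to use up at most half of the decrease \<^term>\<open>2 * c * t * S\<close>\<close>
  define \<rho> where "\<rho> = c * S / (Q + 1)"
  obtain i where "F u $ i \<noteq> 0" using nz by (auto simp: vec_eq_iff)
  then have "0 < m i * \<bar>F u $ i\<bar>" using m by simp
  also have "\<dots> \<le> S" unfolding S_def
    by (rule member_le_sum) (use m in \<open>auto simp: less_imp_le\<close>)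
  finally have S: "S > 0" .
  have M: "M \<ge> 0" unfolding M_def using m by (intro sum_nonneg) (simp add: less_imp_le)
  have E: "E \<ge> 0" by (simp add: E_def)
  note K = lipschitz_const_nonneg
  have Q: "Q \<ge> 0" unfolding Q_def using M E K by simp
  have \<rho>: "\<rho> > 0" unfolding \<rho>_def using S Q rate_pos by (intro divide_pos_pos) auto
  have Q\<rho>: "Q * \<rho> \<le> c * S"
  proof -
    have "Q * \<rho> \<le> (Q + 1) * \<rho>" using \<rho> by (intro mult_right_mono) auto
    also have "\<dots> = c * S" using Q by (simp add: \<rho>_def)
    finally show ?thesis .
  qed
  show ?thesis
  proof (rule that[of "c * S" \<rho>])
    show "c * S > 0" using S rate_pos by simp
    show "\<rho> > 0" by (rule \<rho>)
    fix w t assume w: "dist w u < \<rho>" and t: "0 \<le> t" "t < \<rho>"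
    define w' where "w' = w + t *\<^sub>R e"
    have nw: "norm (w - u) \<le> \<rho>" using w by (simp add: dist_norm)
    have te: "norm (t *\<^sub>R e) \<le> \<rho> * E" using t by (simp add: E_def mult_right_mono)
    have nw': "norm (w' - u) \<le> \<rho> + \<rho> * E"
      using nw te norm_triangle_ineq[of "w - u" "t *\<^sub>R e"] by (simp add: w'_def algebra_simps)
    have "(F w' $ j)\<^sup>2 - (F w $ j)\<^sup>2 \<le> - (2 * c * t * \<bar>F u $ j\<bar>) + K * (t * E) * (K * ((2 + E) * \<rho>))" for j
    proof -
      have d: "\<bar>F w' $ j - F w $ j\<bar> \<le> K * (t * E)"
        using lipschitz[of w' j w] t by (simp add: w'_def E_def)
      have "\<bar>F w $ j - F u $ j\<bar> \<le> K * \<rho>"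
        using lipschitz[of w j u] mult_left_mono[OF nw K] by linarith
      moreover have "\<bar>F w' $ j - F u $ j\<bar> \<le> K * (\<rho> + \<rho> * E)"
        using lipschitz[of w' j u] mult_left_mono[OF nw' K] by linarith
      ultimately have s: "\<bar>F w' $ j + F w $ j - 2 * F u $ j\<bar> \<le> K * ((2 + E) * \<rho>)"
        by (simp add: algebra_simps)
      have "(F w' $ j)\<^sup>2 - (F w $ j)\<^sup>2
          = 2 * ((F w' $ j - F w $ j) * F u $ j)
            + (F w' $ j - F w $ j) * (F w' $ j + F w $ j - 2 * F u $ j)"
        by (simp add: power2_eq_square algebra_simps)
      moreover have "(F w' $ j - F w $ j) * (F w' $ j + F w $ j - 2 * F u $ j)
          \<le> K * (t * E) * (K * ((2 + E) * \<rho>))"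
        using mult_mono[OF d s] t K E by (simp flip: abs_mult)
      ultimately show ?thesis
        using descent[OF t(1), of w' w u j] by (simp add: w'_def e_def)
    qed
    then have "(\<Sum>j\<in>UNIV. m j * ((F w' $ j)\<^sup>2 - (F w $ j)\<^sup>2))
        \<le> (\<Sum>j\<in>UNIV. m j * (- (2 * c * t * \<bar>F u $ j\<bar>) + K * (t * E) * (K * ((2 + E) * \<rho>))))"
      using m by (intro sum_mono mult_left_mono) (auto simp: less_imp_le)
    also have "\<dots> = - (2 * c * t * S) + M * (K * (t * E) * (K * ((2 + E) * \<rho>)))"
      unfolding S_def M_def
      by (simp add: algebra_simps sum.distrib sum_distrib_left sum_distrib_right sum_negf sum_subtractf)
    also have "\<dots> = - (2 * c * t * S) + t * (Q * \<rho>)"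
      by (simp add: Q_def algebra_simps)
    also have "\<dots> \<le> - (c * S * t)" using mult_left_mono[OF Q\<rho> t(1)] by (simp add: algebra_simps)
    finally show "energy m (w + t *\<^sub>R descent_direction u) \<le> energy m w - c * S * t"
      by (simp add: energy_def w'_def e_def right_diff_distrib sum_subtractf)
  qed
qed

text \<open>
  By stability the sublevel set $|F| \le |F(0)|$ is bounded, so $|F|$ has a global minimizer. If it
  were not a zero, the descent direction would decrease $|F|^2$, the energy with unit weights.
\<close>
lemma zero_exists: "\<exists>u. F u = 0"
proof -
  define C where "C = (\<Sum>k\<in>UNIV. \<phi> k / c)"
  have C: "C \<ge> 0" unfolding C_def using weight_pos rate_pos by (intro sum_nonneg) (auto simp: less_imp_le)
  define B where "B = cball (0 :: real^'v) (C * (2 * norm (F 0)))"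
  have "0 \<in> B" using C by (simp add: B_def)
  then have "\<exists>u\<in>B. \<forall>w\<in>B. norm (F u) \<le> norm (F w)"
    by (intro continuous_attains_inf continuous_intros continuous) (auto simp: B_def)
  then obtain u where u: "\<And>w. w \<in> B \<Longrightarrow> norm (F u) \<le> norm (F w)" by blast
  have min: "norm (F u) \<le> norm (F w)" for w
  proof (cases "norm (F w) \<le> norm (F 0)")
    case True
    then have "norm (F w - F 0) \<le> 2 * norm (F 0)" using norm_triangle_ineq4[of "F w" "F 0"] by linarith
    with stability[of w 0] C have "norm w \<le> C * (2 * norm (F 0))"
      by (simp add: C_def) (meson mult_left_mono order_trans)
    then show ?thesis by (intro u) (simp add: B_def)
  next
    case False
    then show ?thesis using u[OF \<open>0 \<in> B\<close>] by linarith
  qed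
  have energy: "energy (\<lambda>_. 1) w = (norm (F w))\<^sup>2" for w
    unfolding energy_def norm_vec_def L2_set_def by (simp add: sum_nonneg)
  show ?thesis
  proof (rule ccontr)
    assume "\<nexists>u. F u = 0"
    then obtain \<eta> \<rho> where \<eta>: "\<eta> > 0" and \<rho>: "\<rho> > 0" and dec:
      "\<And>w t. \<lbrakk>dist w u < \<rho>; 0 \<le> t; t < \<rho>\<rbrakk>
        \<Longrightarrow> energy (\<lambda>_. 1) (w + t *\<^sub>R descent_direction u) \<le> energy (\<lambda>_. 1) w - \<eta> * t"
      using energy_uniform_decrease[of "\<lambda>_. 1" u] by auto
    have "energy (\<lambda>_. 1) (u + (\<rho> / 2) *\<^sub>R descent_direction u) < energy (\<lambda>_. 1) u"
      using dec[of u "\<rho> / 2"] mult_pos_pos[OF \<eta> \<rho>] \<rho> by simp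
    then have "norm (F (u + (\<rho> / 2) *\<^sub>R descent_direction u)) < norm (F u)"
      unfolding energy by (rule power2_less_imp_less) simp
    then show False using min[of "u + (\<rho> / 2) *\<^sub>R descent_direction u"] by linarith
  qed
qed

text \<open>
  Since $F$ is Lipschitz, the energy near a zero of $F$ is at most a multiple of the squared
  distance to it.
\<close>
lemma energy_GDERIV_zero:
  assumes m: "\<And>j. m j \<ge> 0" and "F u = 0"
  shows "GDERIV (energy m) u :> 0"
  unfolding gderiv_def
proof (rule has_derivativeI_sandwich[of 1])
  define M where "M = (\<Sum>j\<in>UNIV. m j * K\<^sup>2)"
  show "bounded_linear (\<lambda>h. h \<bullet> (0 :: real^'v))" by simp
  show "norm (energy m w - energy m u - (w - u) \<bullet> 0) / norm (w - u) \<le> M * norm (w - u)"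
    if "w \<noteq> u" for w
  proof -
    have "(F w $ j)\<^sup>2 \<le> K\<^sup>2 * (norm (w - u))\<^sup>2" for j
      using lipschitz[of w j u] \<open>F u = 0\<close>
      by (simp flip: power_mult_distrib) (metis abs_ge_zero power2_abs power_mono)
    then have "energy m w \<le> (\<Sum>j\<in>UNIV. m j * (K\<^sup>2 * (norm (w - u))\<^sup>2))"
      unfolding energy_def using m by (intro sum_mono mult_left_mono) auto
    also have "\<dots> = M * norm (w - u) * norm (w - u)"
      by (simp add: M_def sum_distrib_right sum_distrib_left power2_eq_square algebra_simps)
    finally have "energy m w \<le> M * norm (w - u) * norm (w - u)" .
    moreover have "energy m w \<ge> 0" unfolding energy_def using m by (intro sum_nonneg) simp
    moreover have "energy m u = 0" using \<open>F u = 0\<close> by (simp add: energy_def)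
    ultimately show ?thesis using that by (simp add: divide_le_eq)
  qed
  show "((\<lambda>w. M * norm (w - u)) \<longlongrightarrow> 0) (at u)"
    by (rule tendsto_eq_intros | simp)+
qed auto

text \<open>
  Away from the zeros of $F$, uniform decrease along one direction $e$ puts all gradients near $u$,
  hence their limits and the convex hull of these, into a half-space that misses $0$. At a zero the
  constant sequence shows that the gradient $0$ belongs to the generalized differential.
\<close>
lemma zero_in_gen_differential_energy_iff:
  assumes m: "\<And>j. m j > 0"
  shows "0 \<in> gen_differential (energy m) u \<longleftrightarrow> F u = 0"
proof
  assume "F u = 0"
  then have "GDERIV (energy m) u :> 0" using m by (intro energy_GDERIV_zero) (auto simp: less_imp_le)
  then show "0 \<in> gen_differential (energy m) u"
    unfolding gen_differential_def
    by (intro hull_inc) (simp, intro exI[of _ "\<lambda>_. u"] exI[of _ "\<lambda>_. 0"], simp)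
next
  assume zero: "0 \<in> gen_differential (energy m) u"
  show "F u = 0"
  proof (rule ccontr)
    assume "F u \<noteq> 0"
    obtain \<eta> \<rho> where \<eta>: "\<eta> > 0" and \<rho>: "\<rho> > 0" and dec:
      "\<And>w t. \<lbrakk>dist w u < \<rho>; 0 \<le> t; t < \<rho>\<rbrakk>
        \<Longrightarrow> energy m (w + t *\<^sub>R descent_direction u) \<le> energy m w - \<eta> * t"
      by (rule energy_uniform_decrease[of m, OF m \<open>F u \<noteq> 0\<close>]) (rule that)
    define e where "e = descent_direction u"
    have slope: "e \<bullet> D \<le> - \<eta>" if D: "GDERIV (energy m) w :> D" and w: "dist w u < \<rho>" for w D
    proof -
      have line: "((\<lambda>t. w + t *\<^sub>R e) has_derivative (\<lambda>t. t *\<^sub>R e)) (at 0)"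
        by (auto intro!: derivative_eq_intros)
      have "((\<lambda>t. energy m (w + t *\<^sub>R e)) has_derivative (\<lambda>t. (t *\<^sub>R e) \<bullet> D)) (at 0)"
        using D by (intro has_derivative_compose[OF line]) (simp add: gderiv_def)
      then have "((\<lambda>t. energy m (w + t *\<^sub>R e)) has_real_derivative e \<bullet> D) (at 0)"
        unfolding has_field_derivative_def by (simp add: mult.commute[of _ "e \<bullet> D"])
      then have der: "((\<lambda>t. energy m (w + t *\<^sub>R e) + \<eta> * t) has_real_derivative e \<bullet> D + \<eta>) (at 0)"
        by (auto intro!: derivative_eq_intros)
      show ?thesis
      proof (rule ccontr)
        assume "\<not> e \<bullet> D \<le> - \<eta>"
        then have "e \<bullet> D + \<eta> > 0" by simp
        from DERIV_pos_inc_right[OF der this] obtain d where d: "d > 0"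
          "\<And>h. 0 < h \<Longrightarrow> h < d \<Longrightarrow> energy m w < energy m (w + h *\<^sub>R e) + \<eta> * h" by auto
        have "0 < min d \<rho> / 2" "min d \<rho> / 2 < d" "min d \<rho> / 2 < \<rho>" using d(1) \<rho> by auto
        then show False
          using d(2)[of "min d \<rho> / 2"] dec[OF w, of "min d \<rho> / 2"] by (simp add: e_def)
      qed
    qed
    have "gen_differential (energy m) u \<subseteq> {d. e \<bullet> d \<le> - \<eta>}"
      unfolding gen_differential_def
    proof (rule hull_minimal)
      show "convex {d. e \<bullet> d \<le> - \<eta>}" by (rule convex_halfspace_le)
      show "{d. \<exists>w D. (\<forall>n::nat. GDERIV (energy m) (w n) :> D n) \<and> w \<longlonglongrightarrow> u \<and> D \<longlonglongrightarrow> d}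
          \<subseteq> {d. e \<bullet> d \<le> - \<eta>}"
      proof clarify
        fix d w D assume *: "\<forall>n::nat. GDERIV (energy m) (w n) :> D n" "w \<longlonglongrightarrow> u" "D \<longlonglongrightarrow> d"
        have "\<forall>\<^sub>F n in sequentially. dist (w n) u < \<rho>" using *(2) \<rho> by (rule tendstoD)
        then have "\<forall>\<^sub>F n in sequentially. e \<bullet> D n \<le> - \<eta>"
          by eventually_elim (use * slope in blast)
        with *(3) show "e \<bullet> d \<le> - \<eta>"
          by (intro tendsto_upperbound[of "\<lambda>n. e \<bullet> D n"]) (auto intro!: tendsto_intros)
      qed
    qed
    with zero \<eta> show False by auto
  qed
qed

end

section \<open>The residual of the scheme\<close>
lemma grad_G_in_vectors_on: "grad_G N dx u j \<in> vectors_on (N j)"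
  by (simp add: grad_G_def)

lemma H1E:
  assumes "H1 N H"
  obtains Cu Cp where "Cu > 0" "Cp > 0"
    "\<And>j u v p. \<lbrakk>j \<in> interior_nodes N; p \<in> vectors_on (N j)\<rbrakk>
      \<Longrightarrow> \<bar>H j u p - H j v p\<bar> \<le> Cu * \<bar>u - v\<bar>"
    "\<And>j u p q. \<lbrakk>j \<in> interior_nodes N; p \<in> vectors_on (N j); q \<in> vectors_on (N j)\<rbrakk>
      \<Longrightarrow> \<bar>H j u p - H j u q\<bar> \<le> Cp * sup_norm_on (N j) (\<lambda>k. p k - q k)"
proof -
  obtain Cu Cp where C: "Cu > 0" "Cp > 0" and *: "\<forall>j\<in>interior_nodes N. \<forall>u v.
     \<forall>p\<in>vectors_on (N j). \<forall>q\<in>vectors_on (N j).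
       \<bar>H j u p - H j v p\<bar> \<le> Cu * \<bar>u - v\<bar> \<and>
       \<bar>H j u p - H j u q\<bar> \<le> Cp * sup_norm_on (N j) (\<lambda>k. p k - q k)"
    using assms unfolding H1_def by blast
  show ?thesis by (rule that[OF C]) (use * in blast)+
qed

lemma H2_mono_slopes:
  assumes "H2 N H" "j \<in> interior_nodes N" "p \<in> vectors_on (N j)" "q \<in> vectors_on (N j)"
    and "\<And>k. k \<in> N j \<Longrightarrow> p k \<le> q k"
  shows "H j u p \<le> H j u q"
  using assms unfolding H2_def by meson

lemma H2_mono_value:
  assumes "H2 N H" "j \<in> interior_nodes N" "p \<in> vectors_on (N j)" "u \<le> v"
  shows "H j u p \<le> H j v p"
  using assms unfolding H2_def by meson

lemma finite_type_bounded_above: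
  fixes f :: "'a::finite \<Rightarrow> real"
  obtains B where "B > 0" "\<And>x. f x \<le> B"
proof (rule that[of "max 1 (MAX x. f x)"])
  show "f x \<le> max 1 (MAX x. f x)" for x by (simp add: le_max_iff_disj)
qed simp

lemma residual_lipschitz:
  fixes N :: "'v::finite \<Rightarrow> 'v set"
  assumes dx: "\<And>j k. k \<in> N j \<Longrightarrow> dx j k > 0" and H1: "H1 N H"
  obtains K where "\<And>w v j. \<bar>residual N dx H g 1 w $ j - residual N dx H g 1 v $ j\<bar> \<le> K * norm (w - v)"
proof -
  obtain Cu Cp where Cu: "Cu > 0" and Cp: "Cp > 0" and
    Hu: "\<And>j u v p. \<lbrakk>j \<in> interior_nodes N; p \<in> vectors_on (N j)\<rbrakk>
      \<Longrightarrow> \<bar>H j u p - H j v p\<bar> \<le> Cu * \<bar>u - v\<bar>" and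
    Hp: "\<And>j u p q. \<lbrakk>j \<in> interior_nodes N; p \<in> vectors_on (N j); q \<in> vectors_on (N j)\<rbrakk>
      \<Longrightarrow> \<bar>H j u p - H j u q\<bar> \<le> Cp * sup_norm_on (N j) (\<lambda>k. p k - q k)"
    by (rule H1E[OF H1]) (rule that)
  obtain D where D: "D > 0" "\<And>j k. 1 / dx j k \<le> D"
    using finite_type_bounded_above[of "\<lambda>(j, k). 1 / dx j k"] by (metis case_prod_conv)
  have "\<bar>residual N dx H g 1 w $ j - residual N dx H g 1 v $ j\<bar>
      \<le> (1 + Cu + Cp * (2 * D)) * norm (w - v)" for w v j
  proof (cases "j \<in> interior_nodes N")
    case False
    then have "\<bar>residual N dx H g 1 w $ j - residual N dx H g 1 v $ j\<bar> \<le> 1 * norm (w - v)"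
      using component_le_norm_cart[of "w - v" j] by (simp add: residual_def)
    also have "\<dots> \<le> (1 + Cu + Cp * (2 * D)) * norm (w - v)"
      using Cu Cp D(1) by (intro mult_right_mono) auto
    finally show ?thesis .
  next
    case True
    let ?p = "grad_G N dx w j" and ?q = "grad_G N dx v j"
    have "\<bar>?p k - ?q k\<bar> \<le> 2 * D * norm (w - v)" if k: "k \<in> N j" for k
    proof -
      have "?p k - ?q k = ((w - v) $ j - (w - v) $ k) * (1 / dx j k)"
        using k by (simp add: grad_G_def algebra_simps diff_divide_distrib add_divide_distrib)
      then have "\<bar>?p k - ?q k\<bar> = \<bar>(w - v) $ j - (w - v) $ k\<bar> * (1 / dx j k)"
        using dx[OF k] by (simp add: abs_mult)
      also have "\<dots> \<le> (2 * norm (w - v)) * D"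
        using component_le_norm_cart[of "w - v" j] component_le_norm_cart[of "w - v" k] D dx[OF k]
        by (intro mult_mono) auto
      finally show ?thesis by (simp add: mult_ac)
    qed
    then have "sup_norm_on (N j) (\<lambda>k. ?p k - ?q k) \<le> 2 * D * norm (w - v)"
      using True by (intro sup_norm_on_le) (auto simp: interior_nodes_def)
    then have "Cp * sup_norm_on (N j) (\<lambda>k. ?p k - ?q k) \<le> Cp * (2 * D * norm (w - v))"
      using Cp by (intro mult_left_mono) auto
    with Hp[where p = ?p and q = ?q and u = "v $ j", OF True grad_G_in_vectors_on grad_G_in_vectors_on]
    have "\<bar>H j (v $ j) ?p - H j (v $ j) ?q\<bar> \<le> Cp * (2 * D * norm (w - v))"
      by (rule order_trans)
    moreover have "Cu * \<bar>w $ j - v $ j\<bar> \<le> Cu * norm (w - v)"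
      using Cu component_le_norm_cart[of "w - v" j] by (intro mult_left_mono) auto
    with Hu[where u = "w $ j" and v = "v $ j" and p = ?p, OF True grad_G_in_vectors_on]
    have "\<bar>H j (w $ j) ?p - H j (v $ j) ?p\<bar> \<le> Cu * norm (w - v)"
      by (rule order_trans)
    ultimately have "\<bar>H j (w $ j) ?p - H j (v $ j) ?q\<bar>
        \<le> norm (w - v) + Cu * norm (w - v) + Cp * (2 * D * norm (w - v))"
      using norm_ge_zero[of "w - v"] by linarith
    then show ?thesis using True by (simp add: residual_def algebra_simps)
  qed
  then show ?thesis by (rule that)
qed

section \<open>The comparison principle under a strict dependence on the unknown\<close>

text \<open>
  With constant weights, all slopes at $j$ are at least as large for $w$ as for $v$ when $w - v$ is
  maximal at $j$. Monotonicity discards them, and (H3) gives the rate. The minimum with $1$ accounts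
  for the boundary components, where the residual grows exactly like $u_j$.
\<close>
lemma weighted_comparison_residual_of_H3:
  fixes N :: "'v::finite \<Rightarrow> 'v set"
  assumes dx: "\<And>j k. k \<in> N j \<Longrightarrow> dx j k > 0" and H2: "H2 N H" and H3: "H3 N H"
    and lip: "\<And>w v j. \<bar>residual N dx H g 1 w $ j - residual N dx H g 1 v $ j\<bar> \<le> K * norm (w - v)"
  shows "\<exists>\<phi> c. weighted_comparison (residual N dx H g 1) \<phi> c K"
proof -
  obtain l where l: "l > 0" and Hl: "\<And>j u v p. \<lbrakk>j \<in> interior_nodes N; p \<in> vectors_on (N j); u \<le> v\<rbrakk>
      \<Longrightarrow> l * (v - u) \<le> H j v p - H j u p"
    using H3 unfolding H3_def by blast
  show ?thesis
  proof (intro exI[of _ "\<lambda>_. 1"] exI[of _ "min l 1"] weighted_comparison.intro lip)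
    show "min l 1 > 0" using l by simp
    show "(1 :: real) > 0" by simp
    fix t j and w v :: "real^'v"
    assume t: "0 \<le> t" and j: "w $ j - v $ j = t * 1" and le: "\<And>k. w $ k - v $ k \<le> t * 1"
    show "min l 1 * t \<le> residual N dx H g 1 w $ j - residual N dx H g 1 v $ j"
    proof (cases "j \<in> interior_nodes N")
      case False
      then show ?thesis using j mult_right_mono[of "min l 1" 1 t] t by (simp add: residual_def)
    next
      case True
      let ?p = "grad_G N dx w j" and ?q = "grad_G N dx v j"
      have slopes: "?q k \<le> ?p k" if k: "k \<in> N j" for k
        using j le[of k] dx[OF k] k by (simp add: grad_G_def divide_right_mono)
      have "H j (w $ j) ?q \<le> H j (w $ j) ?p"
        by (rule H2_mono_slopes[OF H2 True grad_G_in_vectors_on grad_G_in_vectors_on slopes])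
      moreover have "l * (w $ j - v $ j) \<le> H j (w $ j) ?q - H j (v $ j) ?q"
        using j t by (intro Hl True grad_G_in_vectors_on) simp
      moreover have "min l 1 * t \<le> l * t" using t by (intro mult_right_mono) auto
      ultimately show ?thesis using j True by (simp add: residual_def)
    qed
  qed
qed

section \<open>The comparison principle under strict monotonicity in the slopes\<close>

text \<open>
  The rank is the length of a shortest path to the boundary; the second node on such a path is the
  neighbour of smaller rank.
\<close>
lemma path_to_boundary_imp_rank:
  assumes "\<And>j. j \<in> interior_nodes N \<Longrightarrow> \<exists>n\<ge>1. \<exists>c :: nat \<Rightarrow> 'v.
        c 1 = j \<and> (\<forall>i\<in>{1..n}. c i \<in> interior_nodes N) \<and> c (n + 1) \<in> boundary_nodes N \<and>
        (\<forall>i\<in>{1..n}. c (i + 1) \<in> N (c i))"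
  obtains d :: "'v \<Rightarrow> nat" where "\<And>j. j \<in> interior_nodes N \<Longrightarrow> \<exists>k\<in>N j. d k < d j"
proof -
  define E where "E = {(j, k). k \<in> N j}"
  define reach where "reach j n \<longleftrightarrow> (\<exists>b\<in>boundary_nodes N. (j, b) \<in> E ^^ n)" for j n
  define d where "d j = (LEAST n. reach j n)" for j
  have "\<exists>k\<in>N j. d k < d j" if j: "j \<in> interior_nodes N" for j
  proof -
    from assms[OF j] obtain n and c :: "nat \<Rightarrow> 'v" where c: "c 1 = j" "c (n + 1) \<in> boundary_nodes N"
      "\<forall>i\<in>{1..n}. c (i + 1) \<in> N (c i)" by blast
    have "(j, c (n + 1)) \<in> E ^^ n"
      using c(1,3) by (subst relpow_fun_conv, intro exI[of _ "\<lambda>i. c (i + 1)"]) (auto simp: E_def)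
    then have "reach j n" using c(2) by (auto simp: reach_def)
    then have r: "reach j (d j)" unfolding d_def by (rule LeastI)
    then obtain m where m: "d j = Suc m"
      using j by (cases "d j") (auto simp: reach_def interior_nodes_def boundary_nodes_def)
    then obtain b where b: "b \<in> boundary_nodes N" "(j, b) \<in> E ^^ Suc m"
      using r by (auto simp: reach_def simp del: relpow.simps)
    from relpow_Suc_D2[OF b(2)] obtain k where "(j, k) \<in> E" "(k, b) \<in> E ^^ m" by blast
    with b(1) have "k \<in> N j" "reach k m" by (auto simp: E_def reach_def)
    moreover from \<open>reach k m\<close> have "d k \<le> m" unfolding d_def by (rule Least_le)
    ultimately show ?thesis using m \<open>k \<in> N j\<close> by (auto simp: less_Suc_eq_le)
  qed
  then show ?thesis by (rule that)
qed

text \<open>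
  Let $w - v$ touch $t \varphi$ at an interior node $j$ from below and put $s = t \theta^{d_j}$. The
  slope towards $k$ increases by at least $t (\theta^{d_k} - \theta^{d_j}) / \Delta x_{jk}$. So no
  slope decreases by more than $s D$, which costs at most $[\mathcal{H}]_p\, s D$, while towards a
  neighbour $m$ with $d_m < d_j$ the slope increases by at least
  $s (1/\theta - 1) / \Delta x_{jm} \ge s Q$, which gains at least $\underline\alpha s Q$. The
  constant $Q$ is such that the balance is exactly $s$. Here $D$ bounds the inverse
  distances, $\Delta$ bounds the distances, and $\theta$ is determined by $1/\theta - 1 = \Delta Q$.
\<close>
lemma weighted_comparison_residual_of_H4:
  fixes N :: "'v::finite \<Rightarrow> 'v set"
  assumes dx: "\<And>j k. k \<in> N j \<Longrightarrow> dx j k > 0" and H1: "H1 N H" and H2: "H2 N H" and H4: "H4 N H"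
    and lip: "\<And>w v j. \<bar>residual N dx H g 1 w $ j - residual N dx H g 1 v $ j\<bar> \<le> K * norm (w - v)"
  shows "\<exists>\<phi> c. weighted_comparison (residual N dx H g 1) \<phi> c K"
proof -
  obtain Cp where Cp: "Cp > 0" and
    Hp: "\<And>j u p q. \<lbrakk>j \<in> interior_nodes N; p \<in> vectors_on (N j); q \<in> vectors_on (N j)\<rbrakk>
      \<Longrightarrow> \<bar>H j u p - H j u q\<bar> \<le> Cp * sup_norm_on (N j) (\<lambda>k. p k - q k)"
    by (rule H1E[OF H1]) (rule that)
  note H4' = H4[unfolded H4_def]
  from conjunct1[OF H4'] obtain \<alpha> where \<alpha>: "\<alpha> > 0" and
    AE: "\<forall>j\<in>interior_nodes N. \<forall>u. \<forall>k\<in>N j. AE p in Pi\<^sub>M (N j) (\<lambda>_. lborel).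
          \<exists>d\<ge>\<alpha>. ((\<lambda>t. H j u (p(k := t))) has_real_derivative d) (at (p k))"
    by (elim exE conjE) (rule that)
  have growth: "\<alpha> * (y - x) \<le> H j u (p(k := y)) - H j u (p(k := x))"
    if "j \<in> interior_nodes N" "k \<in> N j" "p \<in> vectors_on (N j)" "x \<le> y" for j k u p x y
    by (rule AE_partial_deriv_ge_growth[where h = "H j u" and A = "N j",
          OF that(2) Cp Hp[OF that(1)] AE[rule_format, OF that(1,2)] that(3,4)])
  obtain d where d: "\<And>j. j \<in> interior_nodes N \<Longrightarrow> \<exists>k\<in>N j. d k < (d j :: nat)"
    by (rule path_to_boundary_imp_rank[OF bspec[OF conjunct1[OF conjunct2[OF H4']]]])
       (assumption, rule that)
  obtain D where D: "D > 0" "\<And>j k. 1 / dx j k \<le> D"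
    using finite_type_bounded_above[of "\<lambda>(j, k). 1 / dx j k"] by (metis case_prod_conv)
  obtain \<Delta> where \<Delta>: "\<Delta> > 0" "\<And>j k. dx j k \<le> \<Delta>"
    using finite_type_bounded_above[of "\<lambda>(j, k). dx j k"] by (metis case_prod_conv)
  define Q where "Q = (Cp * D + 1) / \<alpha>"
  have Q: "Q > 0" unfolding Q_def using Cp D \<alpha> by (intro divide_pos_pos add_pos_pos mult_pos_pos) auto
  define \<theta> where "\<theta> = 1 / (1 + \<Delta> * Q)"
  have \<theta>: "0 < \<theta>" "\<theta> < 1" using mult_pos_pos[OF \<Delta>(1) Q] by (simp_all add: \<theta>_def)
  define \<phi> where "\<phi> j = 2 - \<theta> ^ d j" for j
  have \<phi>: "\<phi> j \<ge> 1" for j using \<theta> by (simp add: \<phi>_def power_le_one)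
  define c where "c = \<theta> ^ (MAX j. d j)"
  have c: "0 < c" "c \<le> 1" using \<theta> by (simp_all add: c_def power_le_one)
  have c\<theta>: "c \<le> \<theta> ^ d j" for j using \<theta> by (simp add: c_def power_decreasing)
  show ?thesis
  proof (intro exI[of _ \<phi>] exI[of _ c] weighted_comparison.intro lip)
    show "\<phi> j > 0" for j using \<phi>[of j] by simp
    show "c > 0" by (rule c)
    fix t j and w v :: "real^'v"
    assume t: "0 \<le> t" and j: "w $ j - v $ j = t * \<phi> j" and le: "\<And>k. w $ k - v $ k \<le> t * \<phi> k"
    show "c * t \<le> residual N dx H g 1 w $ j - residual N dx H g 1 v $ j"
    proof (cases "j \<in> interior_nodes N")
      case False
      have "c * t \<le> \<phi> j * t" using c(2) \<phi>[of j] t by (intro mult_right_mono) auto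
      then show ?thesis using j False by (simp add: residual_def mult.commute)
    next
      case True
      let ?p = "grad_G N dx w j" and ?q = "grad_G N dx v j"
      define s where "s = t * \<theta> ^ d j"
      have s: "s \<ge> 0" using t \<theta> by (simp add: s_def)
      have diff: "t * (\<theta> ^ d k - \<theta> ^ d j) / dx j k \<le> ?p k - ?q k" if k: "k \<in> N j" for k
      proof -
        have "?p k - ?q k = ((w $ j - v $ j) - (w $ k - v $ k)) / dx j k"
          using k by (simp add: grad_G_def diff_divide_distrib)
        moreover have "t * (\<theta> ^ d k - \<theta> ^ d j) \<le> (w $ j - v $ j) - (w $ k - v $ k)"
          using j le[of k] by (simp add: \<phi>_def algebra_simps)
        ultimately show ?thesis using dx[OF k] by (simp add: divide_right_mono)
      qed
      obtain m where m: "m \<in> N j" "d m < d j" using d[OF True] by blast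
      have loss: "?q k - s * D \<le> ?p k" if k: "k \<in> N j" for k
      proof -
        have "s * (1 / dx j k) \<le> s * D" using s D by (intro mult_left_mono) auto
        moreover have "- s / dx j k \<le> t * (\<theta> ^ d k - \<theta> ^ d j) / dx j k"
          using t \<theta> dx[OF k] by (intro divide_right_mono) (auto simp: s_def algebra_simps)
        ultimately show ?thesis using diff[OF k] by simp
      qed
      have gain: "?q m + s * Q \<le> ?p m"
      proof -
        have "\<theta> ^ d j * (\<Delta> * Q) = \<theta> ^ d j / \<theta> - \<theta> ^ d j"
          by (simp add: \<theta>_def algebra_simps)
        also have "\<theta> ^ d j / \<theta> = \<theta> ^ (d j - 1)" using m(2) \<theta> by (simp add: power_diff)
        also have "\<theta> ^ (d j - 1) \<le> \<theta> ^ d m" using m(2) \<theta> by (intro power_decreasing) auto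
        finally have "t * (\<theta> ^ d j * (\<Delta> * Q)) \<le> t * (\<theta> ^ d m - \<theta> ^ d j)"
          using t by (intro mult_left_mono) auto
        then have *: "s * Q * \<Delta> \<le> t * (\<theta> ^ d m - \<theta> ^ d j)" by (simp add: s_def mult_ac)
        have "s * Q * dx j m \<le> s * Q * \<Delta>" using s Q \<Delta> by (intro mult_left_mono) auto
        with * have "s * Q \<le> t * (\<theta> ^ d m - \<theta> ^ d j) / dx j m"
          using dx[OF m(1)] by (simp add: pos_le_divide_eq)
        with diff[OF m(1)] show ?thesis by simp
      qed
      \<comment> \<open>go from the slopes of $v$ to those of $w$ in three steps: lower all slopes by \<^term>\<open>s * D\<close>, raise the one towards $m$, then use monotonicity\<close>
      define r where "r = (\<lambda>k\<in>N j. ?q k - s * D)"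
      have r: "r \<in> vectors_on (N j)" by (simp add: r_def)
      have rx: "r(m := x) \<in> vectors_on (N j)" for x using r m(1) by (auto simp: PiE_def extensional_def)
      have "sup_norm_on (N j) (\<lambda>k. r k - ?q k) \<le> s * D"
        using m(1) s D by (intro sup_norm_on_le) (auto simp: r_def)
      then have "Cp * sup_norm_on (N j) (\<lambda>k. r k - ?q k) \<le> Cp * (s * D)"
        using Cp by (intro mult_left_mono) auto
      with Hp[OF True r grad_G_in_vectors_on[of N dx v], of "v $ j"]
      have 1: "H j (v $ j) ?q - Cp * (s * D) \<le> H j (v $ j) r" by (simp add: abs_le_iff)
      have "\<alpha> * (r m + s * Q - r m) \<le> H j (v $ j) (r(m := r m + s * Q)) - H j (v $ j) (r(m := r m))"
        using s Q by (intro growth True m r) auto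
      then have 2: "H j (v $ j) r + \<alpha> * (s * Q) \<le> H j (v $ j) (r(m := r m + s * Q))" by simp
      have slopes: "(r(m := r m + s * Q)) k \<le> ?p k" if "k \<in> N j" for k
        using loss[OF that] gain that mult_nonneg_nonneg[OF s less_imp_le[OF D(1)]]
        by (auto simp: r_def)
      have 3: "H j (v $ j) (r(m := r m + s * Q)) \<le> H j (v $ j) ?p"
        by (rule H2_mono_slopes[OF H2 True rx grad_G_in_vectors_on slopes])
      have "v $ j \<le> w $ j" using j t \<phi>[of j] mult_nonneg_nonneg[of t "\<phi> j"] by linarith
      then have 4: "H j (v $ j) ?p \<le> H j (w $ j) ?p"
        using True by (intro H2_mono_value[OF H2] grad_G_in_vectors_on)
      have "\<alpha> * (s * Q) - Cp * (s * D) = s" using \<alpha> by (simp add: Q_def field_simps)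
      with 1 2 3 4 have "s \<le> H j (w $ j) ?p - H j (v $ j) ?q" by linarith
      moreover have "c * t \<le> s" using mult_right_mono[OF c\<theta>[of j] t] by (simp add: s_def mult.commute)
      ultimately show ?thesis using True by (simp add: residual_def)
    qed
  qed
qed

lemma residual_eq_0_iff_solves:
  assumes "lam_b > 0"
  shows "residual N dx H g lam_b u = 0 \<longleftrightarrow> solves N dx H g u"
  using assms by (auto simp: residual_def solves_def vec_eq_iff interior_nodes_def boundary_nodes_def)

text \<open>
  The residual with boundary constant $1$ represents the loss for every $\mu_b$, since $\mu_b$ can
  be absorbed into the weights. So one comparison principle covers all $\mu_b$ and $\lambda_b$.
\<close>
lemma loss_eq_weighted_residual:
  fixes N :: "'v::finite \<Rightarrow> 'v set"
  shows "loss N dx H g mu_b u = (\<Sum>j\<in>UNIV.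
    (if j \<in> interior_nodes N then 1 / real (card (interior_nodes N))
     else mu_b / real (card (boundary_nodes N))) * (residual N dx H g 1 u $ j)\<^sup>2)"
proof -
  have split: "UNIV = interior_nodes N \<union> boundary_nodes N" "interior_nodes N \<inter> boundary_nodes N = {}"
    by (auto simp: interior_nodes_def boundary_nodes_def)
  then have "j \<notin> interior_nodes N" if "j \<in> boundary_nodes N" for j using that by blast
  then show ?thesis
    by (subst split(1), subst sum.union_disjoint)
       (auto simp: split(2) loss_def residual_def sum_distrib_left)
qed

section \<open>Unique solvability and critical points of the loss\<close>
theorem theorem1:
  fixes N :: "'v::finite \<Rightarrow> 'v set"
    and dx :: "'v \<Rightarrow> 'v \<Rightarrow> real"
    and H :: "'v \<Rightarrow> real \<Rightarrow> ('v \<Rightarrow> real) \<Rightarrow> real"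
    and g :: "'v \<Rightarrow> real"
  assumes "\<And>j. j \<notin> N j"
    and "interior_nodes N \<noteq> {}"
    and "boundary_nodes N \<noteq> {}"
    and "\<And>j k. k \<in> N j \<Longrightarrow> dx j k > 0"
    and "H1 N H"
    and "H2 N H"
    and "H3 N H \<or> H4 N H"
  shows "(\<exists>!u :: real^'v. solves N dx H g u) \<and>
    (\<forall>mu_b>0.
       (\<forall>u. solves N dx H g u \<longrightarrow>
          (\<forall>v. 0 \<in> gen_differential (loss N dx H g mu_b) v \<longleftrightarrow> v = u)) \<and>
       (\<forall>lam_b>0. \<forall>u.
          0 \<in> gen_differential (loss N dx H g mu_b) u \<longleftrightarrow> residual N dx H g lam_b u = 0))"
proof -
  obtain K where K: "\<And>w v j. \<bar>residual N dx H g 1 w $ j - residual N dx H g 1 v $ j\<bar> \<le> K * norm (w - v)"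
    using residual_lipschitz[of N dx H g] assms(4,5) by blast
  have "\<exists>\<phi> c. weighted_comparison (residual N dx H g 1) \<phi> c K"
    using assms(7)
  proof
    assume "H3 N H"
    then show ?thesis by (intro weighted_comparison_residual_of_H3 assms(4,6) K)
  next
    assume "H4 N H"
    then show ?thesis by (intro weighted_comparison_residual_of_H4 assms(4,5,6) K)
  qed
  then obtain \<phi> c where "weighted_comparison (residual N dx H g 1) \<phi> c K" by blast
  then interpret weighted_comparison "residual N dx H g 1" \<phi> c K .
  have unique: "\<exists>!u. solves N dx H g u"
    using zero_exists zero_unique residual_eq_0_iff_solves[of 1 N dx H g] by (metis zero_less_one)
  have crit: "0 \<in> gen_differential (loss N dx H g mu_b) u \<longleftrightarrow> solves N dx H g u"
    if mu: "mu_b > 0" for mu_b u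
  proof -
    \<comment> \<open>the weights are positive because both kinds of nodes exist\<close>
    define m where "m j = (if j \<in> interior_nodes N then 1 / real (card (interior_nodes N))
     else mu_b / real (card (boundary_nodes N)))" for j
    have "loss N dx H g mu_b = energy m"
      by (rule ext) (simp add: loss_eq_weighted_residual energy_def m_def)
    moreover have "m j > 0" for j
      using mu assms(2,3) by (simp add: m_def card_gt_0_iff)
    ultimately show ?thesis
      using zero_in_gen_differential_energy_iff[of m u] residual_eq_0_iff_solves[of 1 N dx H g u] by simp
  qed
  show ?thesis using unique crit residual_eq_0_iff_solves[of _ N dx H g] by blast
qed

end
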